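(* Assume the cost $c$ is symmetric, i.e. $c(x,y)=c(y,x)$ for all $x,y$. If there exists $\theta_0$ for which $\mathbf q=G_{\theta_0}(\mathbf p)$, then, for any $\lambda>0$, $\theta_0$ is a stationary solution of $\theta\mapsto L_\lambda(G_\theta(\mathbf p),\mathbf q)$, i.e. $\nabla_\theta L_\lambda(G_\theta(\mathbf p),\mathbf q)\big|_{\theta=\theta_0}=0$. Moreover, $L_\lambda(G_{\theta_0}(\mathbf p),\mathbf q)=0$ for any $\lambda>0$.
   Context: $c:\mathbb R^d\times\mathbb R^d\to\mathbb R$ is a cost function. For probability distributions $\mu,\nu$ on $\mathbb R^d$, $\Pi(\mu,\nu)$ is the set of joint distributions with marginals $\mu$ and $\nu$. $I$ is either the KL regularizer, $I(\pi)=\int\log\frac{d\pi}{d(\mu\times\nu)}\,d\pi$, or the norm-2 regularizer, $I(\pi)=\frac12\int\big(\frac{d\pi}{d(\mu\times\nu)}\big)^2d(\mu\times\nu)$. For $\lambda>0$ the regularized optimal transport cost is $$d_{c,\lambda}(\mu,\nu)=\min_{\pi\in\Pi(\mu,\nu)}\int c(x,y)\,d\pi(x,y)+\lambda I(\pi),$$ and $\bar d_{c,\lambda}(\mu,\nu)=d_{c,\lambda}(\mu,\nu)-\lambda I(\pi^* )$, where $\pi^*$ is the (unique) minimizer; that is, $\bar d_{c,\lambda}(\mu,\nu)=\int c\,d\pi^*$. The Sinkhorn loss is $$L_\lambda(\mu,\nu)=2\bar d_{c,\lambda}(\mu,\nu)-\bar d_{c,\lambda}(\mu,\mu)-\bar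 d_{c,\lambda}(\nu,\nu).$$ In this statement $\mathbf p$ is the base distribution on a space $\mathcal X$, $\mathbf q$ is a distribution on $\mathbb R^d$, $\{G_\theta\}$ is a family of one-to-one maps $\mathcal X\to\mathbb R^d$ parametrized by $\theta$ in an open subset of a Euclidean space, and $G_\theta(\mathbf p)$ is the pushforward distribution. It is implicit that $c$ and $G_\theta$ are differentiable and that $(\theta,\theta')\mapsto\bar d_{c,\lambda}(G_\theta(\mathbf p),G_{\theta'}(\mathbf p))$ is differentiable, so that the gradients in $\theta$ make sense. *)

theory Defs
  imports "HOL-Probability.Probability"
begin

definition couplings :: "'a measure \<Rightarrow> 'b measure \<Rightarrow> ('a \<times> 'b) measure set" where
  "couplings \<mu> \<nu> = {\<pi>. prob_space \<pi> \<and> sets \<pi> = sets (\<mu> \<Otimes>\<^sub>M \<nu>) \<and>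
     distr \<pi> \<mu> fst = \<mu> \<and> distr \<pi> \<nu> snd = \<nu>}"

datatype regularizer = KL | Norm2

(* Both regularizers take the value \<infinity> when \<pi> is not absolutely continuous with respect to
   the product measure. In the KL case, the negative part of the log-density is always
   \<pi>-integrable (t ln t is bounded below), so failure of integrability means that the
   divergence is \<infinity>; the guard is needed because the Bochner integral would then be 0. *)
fun reg :: "regularizer \<Rightarrow> 'a measure \<Rightarrow> 'b measure \<Rightarrow> ('a \<times> 'b) measure \<Rightarrow> ereal" where
  "reg KL \<mu> \<nu> \<pi> =
     (if absolutely_continuous (\<mu> \<Otimes>\<^sub>M \<nu>) \<pi> \<and>
         integrable \<pi> (entropy_density (exp 1) (\<mu> \<Otimes>\<^sub>M \<nu>) \<pi>)
      then ereal (KL_divergence (exp 1) (\<mu> \<Otimes>\<^sub>M \<nu>) \<pi>) else \<infinity>)"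
| "reg Norm2 \<mu> \<nu> \<pi> =
     (if absolutely_continuous (\<mu> \<Otimes>\<^sub>M \<nu>) \<pi>
      then enn2ereal ((\<integral>\<^sup>+ z. (RN_deriv (\<mu> \<Otimes>\<^sub>M \<nu>) \<pi> z)\<^sup>2 \<partial>(\<mu> \<Otimes>\<^sub>M \<nu>)) / 2) else \<infinity>)"

(* Extended-real integral of c: positive part minus negative part. Where this is \<infinity> - \<infinity>,
   ereal arithmetic gives \<infinity>, so such \<pi> never compete in the minimization. *)
definition transport_cost :: "('a \<Rightarrow> 'b \<Rightarrow> real) \<Rightarrow> ('a \<times> 'b) measure \<Rightarrow> ereal" where
  "transport_cost c \<pi> =
     enn2ereal (\<integral>\<^sup>+ (x, y). ennreal (c x y) \<partial>\<pi>) - enn2ereal (\<integral>\<^sup>+ (x, y). ennreal (- c x y) \<partial>\<pi>)"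

definition rot_objective ::
  "('a \<Rightarrow> 'b \<Rightarrow> real) \<Rightarrow> regularizer \<Rightarrow> real \<Rightarrow> 'a measure \<Rightarrow> 'b measure \<Rightarrow> ('a \<times> 'b) measure \<Rightarrow> ereal"
  where "rot_objective c R l \<mu> \<nu> \<pi> = transport_cost c \<pi> + ereal l * reg R \<mu> \<nu> \<pi>"

definition rot_cost ::
  "('a \<Rightarrow> 'b \<Rightarrow> real) \<Rightarrow> regularizer \<Rightarrow> real \<Rightarrow> 'a measure \<Rightarrow> 'b measure \<Rightarrow> ereal"
  where "rot_cost c R l \<mu> \<nu> = (INF \<pi> \<in> couplings \<mu> \<nu>. rot_objective c R l \<mu> \<nu> \<pi>)"

(* The minimum is a real number, so a minimizer has finite objective. *)
definition is_optimal_plan ::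
  "('a \<Rightarrow> 'b \<Rightarrow> real) \<Rightarrow> regularizer \<Rightarrow> real \<Rightarrow> 'a measure \<Rightarrow> 'b measure \<Rightarrow> ('a \<times> 'b) measure \<Rightarrow> bool"
  where "is_optimal_plan c R l \<mu> \<nu> \<pi> \<longleftrightarrow>
     \<pi> \<in> couplings \<mu> \<nu> \<and> \<bar>rot_objective c R l \<mu> \<nu> \<pi>\<bar> \<noteq> \<infinity> \<and>
     (\<forall>\<pi>' \<in> couplings \<mu> \<nu>. rot_objective c R l \<mu> \<nu> \<pi> \<le> rot_objective c R l \<mu> \<nu> \<pi>')"

definition optimal_plan ::
  "('a \<Rightarrow> 'b \<Rightarrow> real) \<Rightarrow> regularizer \<Rightarrow> real \<Rightarrow> 'a measure \<Rightarrow> 'b measure \<Rightarrow> ('a \<times> 'b) measure"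
  where "optimal_plan c R l \<mu> \<nu> = (THE \<pi>. is_optimal_plan c R l \<mu> \<nu> \<pi>)"

(* Regularized cost with the regularization term removed; see sharp_cost_eq below. *)
definition sharp_cost ::
  "('a \<Rightarrow> 'b \<Rightarrow> real) \<Rightarrow> regularizer \<Rightarrow> real \<Rightarrow> 'a measure \<Rightarrow> 'b measure \<Rightarrow> real"
  where "sharp_cost c R l \<mu> \<nu> = (\<integral>(x, y). c x y \<partial>(optimal_plan c R l \<mu> \<nu>))"

definition sinkhorn_loss ::
  "('a \<Rightarrow> 'a \<Rightarrow> real) \<Rightarrow> regularizer \<Rightarrow> real \<Rightarrow> 'a measure \<Rightarrow> 'a measure \<Rightarrow> real"
  where "sinkhorn_loss c R l \<mu> \<nu> =
     2 * sharp_cost c R l \<mu> \<nu> - sharp_cost c R l \<mu> \<mu> - sharp_cost c R l \<nu> \<nu>"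

lemma rot_cost_eq:
  assumes "is_optimal_plan c R l \<mu> \<nu> \<pi>"
  shows "rot_cost c R l \<mu> \<nu> = rot_objective c R l \<mu> \<nu> \<pi>"
  using assms unfolding rot_cost_def is_optimal_plan_def
  by (auto intro!: antisym INF_lower INF_greatest)

lemma transport_cost_finite:
  assumes c: "(\<lambda>(x, y). c x y) \<in> borel_measurable \<pi>"
    and fin: "\<bar>transport_cost c \<pi>\<bar> \<noteq> \<infinity>"
  shows "integrable \<pi> (\<lambda>(x, y). c x y)"
    and "transport_cost c \<pi> = ereal (\<integral>(x, y). c x y \<partial>\<pi>)"
proof -
  let ?P = "\<integral>\<^sup>+ z. ennreal (case z of (x, y) \<Rightarrow> c x y) \<partial>\<pi>"
  let ?N = "\<integral>\<^sup>+ z. ennreal (- (case z of (x, y) \<Rightarrow> c x y)) \<partial>\<pi>"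
  have eq: "transport_cost c \<pi> = enn2ereal ?P - enn2ereal ?N"
    by (simp add: transport_cost_def case_prod_beta')
  obtain a b where ab: "?P = ennreal a" "0 \<le> a" "?N = ennreal b" "0 \<le> b"
    using fin unfolding eq by (cases ?P; cases ?N) (auto simp: enn2ereal_ennreal)
  show int: "integrable \<pi> (\<lambda>(x, y). c x y)"
    unfolding real_integrable_def using c ab by simp
  show "transport_cost c \<pi> = ereal (\<integral>(x, y). c x y \<partial>\<pi>)"
    unfolding eq real_lebesgue_integral_def[OF int] using ab by (simp add: enn2ereal_ennreal)
qed

lemma sharp_cost_eq:
  assumes ex: "\<exists>!\<pi>. is_optimal_plan c R l \<mu> \<nu> \<pi>"
    and c: "(\<lambda>(x, y). c x y) \<in> borel_measurable (\<mu> \<Otimes>\<^sub>M \<nu>)"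
  shows "ereal (sharp_cost c R l \<mu> \<nu>) =
    rot_cost c R l \<mu> \<nu> - ereal l * reg R \<mu> \<nu> (optimal_plan c R l \<mu> \<nu>)"
proof -
  let ?\<pi> = "optimal_plan c R l \<mu> \<nu>"
  have opt: "is_optimal_plan c R l \<mu> \<nu> ?\<pi>"
    unfolding optimal_plan_def using ex by (rule theI')
  then have "sets ?\<pi> = sets (\<mu> \<Otimes>\<^sub>M \<nu>)"
    and fin: "\<bar>transport_cost c ?\<pi> + ereal l * reg R \<mu> \<nu> ?\<pi>\<bar> \<noteq> \<infinity>"
    by (auto simp: is_optimal_plan_def couplings_def rot_objective_def)
  then have c': "(\<lambda>(x, y). c x y) \<in> borel_measurable ?\<pi>"
    using c by (simp cong: measurable_cong_sets)
  have f1: "\<bar>transport_cost c ?\<pi>\<bar> \<noteq> \<infinity>" and f2: "\<bar>ereal l * reg R \<mu> \<nu> ?\<pi>\<bar> \<noteq> \<infinity>"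
    using fin by (cases "transport_cost c ?\<pi>"; cases "ereal l * reg R \<mu> \<nu> ?\<pi>"; simp)+
  have "transport_cost c ?\<pi> = ereal (sharp_cost c R l \<mu> \<nu>)"
    unfolding sharp_cost_def by (rule transport_cost_finite(2)[OF c' f1])
  then show ?thesis
    unfolding rot_cost_eq[OF opt] rot_objective_def using f2
    by (cases "ereal l * reg R \<mu> \<nu> ?\<pi>") auto
qed

end

theory Submission
  imports Defs
begin

text \<open>
  The sharp cost is symmetric in its two arguments when \<open>c\<close> is symmetric, because swapping
  coordinates maps couplings of \<open>(\<mu>, \<nu>)\<close> to couplings of \<open>(\<nu>, \<mu>)\<close> and preserves the objective.
  This transfers to the minimizer since the latter is unique: both regularizers integrate a
  strictly convex function of the density, so the midpoint of two distinct minimizers would do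
  strictly better. A symmetric function \<open>F\<close> has a symmetric derivative \<open>D\<close> at a diagonal point,
  whence \<open>\<theta> \<mapsto> 2 F(\<theta>, \<theta>\<^sub>0) - F(\<theta>, \<theta>)\<close> has derivative \<open>2 D(h, 0) - D(h, h) = D(h, 0) - D(0, h) = 0\<close>.
\<close>

section \<open>Strict convexity of the regularizers\<close>

text \<open>Both regularizers are integrals of a function of the density against the product
  measure; naming that function lets the rest be argued once for both. At \<open>t = 0\<close> the
  KL branch is 0, the continuous extension of \<open>t * ln t\<close>.\<close>

fun reg_integrand :: "regularizer \<Rightarrow> real \<Rightarrow> real" where
  "reg_integrand KL t = t * ln t"
| "reg_integrand Norm2 t = t\<^sup>2 / 2"

lemma borel_measurable_reg_integrand [measurable]: "reg_integrand R \<in> borel_measurable borel"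
  by (cases R) (simp_all add: reg_integrand.simps[abs_def])

text \<open>The graph of \<open>t * ln t\<close> lies above its tangent at \<open>m\<close>,
  touching it only there. This is \<open>ln x \<le> x - 1\<close> at \<open>x = m / s\<close>, with
  equality only for \<open>x = 1\<close>; the point \<open>s = 0\<close> is checked
  directly.\<close>

lemma mult_ln_tangent:
  fixes s m :: real
  assumes "0 \<le> s" "0 < m"
  shows "s * ln m - s * ln s \<le> m - s"
    and "s \<noteq> m \<Longrightarrow> s * ln m - s * ln s < m - s"
proof -
  have eq: "s * ln m - s * ln s = s * ln (m / s)" "m - s = s * (m / s - 1)" if "s > 0"
    using that assms by (simp_all add: ln_div field_simps)
  show "s * ln m - s * ln s \<le> m - s"
  proof (cases "s = 0")
    case False
    with assms have s: "s > 0" by simp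
    then show ?thesis
      unfolding eq[OF s] using assms by (intro mult_left_mono ln_le_minus_one) auto
  qed (use assms in simp)
  show "s * ln m - s * ln s < m - s" if "s \<noteq> m"
  proof (cases "s = 0")
    case False
    with assms have s: "s > 0" by simp
    have "ln (m / s) \<noteq> m / s - 1"
      using ln_eq_minus_one[of "m / s"] s assms that by auto
    moreover have "ln (m / s) \<le> m / s - 1"
      using s assms by (intro ln_le_minus_one) simp
    ultimately show ?thesis
      unfolding eq[OF s] using s by (intro mult_strict_left_mono) auto
  qed (use assms in simp)
qed

text \<open>For KL this is the tangent bound at 1, which gives \<open>t * ln t \<ge> t - 1\<close>.
  The constant is not sharp, but any constant is integrable against a probability measure, which is
  what \<open>is_optimal_plan_unique\<close> requires.\<close>

lemma reg_integrand_ge: "- 1 \<le> reg_integrand R t" if "0 \<le> t"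
proof (cases R)
  case KL
  then show ?thesis using mult_ln_tangent(1)[OF that, of 1] that by simp
next
  case Norm2
  have "0 \<le> t\<^sup>2 / 2" by simp
  then show ?thesis unfolding Norm2 reg_integrand.simps by linarith
qed

text \<open>For KL, the tangent bounds at the midpoint for \<open>s\<close> and \<open>t\<close> are
  added: the linear terms cancel, and strictness comes from \<open>s\<close> differing from the
  midpoint. For the norm-2 case the gap is exactly \<open>(s - t)\<^sup>2 / 8\<close>.\<close>

lemma reg_integrand_midpoint_less:
  assumes "0 \<le> s" "0 \<le> t" "s \<noteq> t"
  shows "reg_integrand R ((s + t) / 2) < (reg_integrand R s + reg_integrand R t) / 2"
proof (cases R)
  case KL
  let ?m = "(s + t) / 2"
  have m: "0 < ?m" "s \<noteq> ?m" using assms by auto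
  have "s * ln ?m - s * ln s < ?m - s" "t * ln ?m - t * ln t \<le> ?m - t"
    using assms m by (intro mult_ln_tangent; simp)+
  then have "(s * ln ?m - s * ln s) + (t * ln ?m - t * ln t) < 0"
    by (auto simp: field_simps)
  then show ?thesis unfolding KL by (simp add: field_simps)
next
  case Norm2
  have "0 < (s - t)\<^sup>2" using assms by simp
  then show ?thesis unfolding Norm2 by (simp add: power2_eq_square field_simps)
qed

lemma reg_integrand_midpoint_le:
  assumes "0 \<le> s" "0 \<le> t"
  shows "reg_integrand R ((s + t) / 2) \<le> (reg_integrand R s + reg_integrand R t) / 2"
  using reg_integrand_midpoint_less[OF assms] by (cases "s = t") (auto simp: less_imp_le)

section \<open>The objective in terms of real densities\<close>

text \<open>A finite measure has an almost everywhere finite Radon-Nikodym derivative, so a real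
  representative exists. Real values allow the subtraction in the later convexity argument.\<close>

lemma absolutely_continuous_density_real:
  assumes "prob_space \<mu>" "prob_space \<nu>" "prob_space \<pi>"
    and "sets \<pi> = sets (\<mu> \<Otimes>\<^sub>M \<nu>)" and "absolutely_continuous (\<mu> \<Otimes>\<^sub>M \<nu>) \<pi>"
  obtains f :: "_ \<Rightarrow> real" where "f \<in> borel_measurable (\<mu> \<Otimes>\<^sub>M \<nu>)" "\<And>z. 0 \<le> f z"
    "\<pi> = density (\<mu> \<Otimes>\<^sub>M \<nu>) (\<lambda>z. ennreal (f z))"
proof -
  interpret \<mu>: prob_space \<mu> by fact
  interpret \<nu>: prob_space \<nu> by fact
  interpret \<pi>: prob_space \<pi> by fact
  interpret M: pair_prob_space \<mu> \<nu> ..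
  obtain f where f: "f \<in> borel_measurable (\<mu> \<Otimes>\<^sub>M \<nu>)"
    "AE z in \<mu> \<Otimes>\<^sub>M \<nu>. RN_deriv (\<mu> \<Otimes>\<^sub>M \<nu>) \<pi> z = ennreal (f z)" "\<And>z. 0 \<le> f z"
    using M.real_RN_deriv[OF \<pi>.finite_measure_axioms assms(5,4)] by metis
  have "\<pi> = density (\<mu> \<Otimes>\<^sub>M \<nu>) (RN_deriv (\<mu> \<Otimes>\<^sub>M \<nu>) \<pi>)"
    using M.density_RN_deriv assms by simp
  also have "\<dots> = density (\<mu> \<Otimes>\<^sub>M \<nu>) (\<lambda>z. ennreal (f z))"
    using f by (intro density_cong) auto
  finally show thesis using f that by blast
qed

text \<open>Brings both regularizers to one form. The infinite value appears exactly when the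
  integrand fails to be integrable: for KL this is the guard in \<open>reg\<close>, for norm 2 it
  holds because a nonnegative measurable function that is not integrable has infinite
  integral.\<close>

lemma reg_density:
  fixes f :: "'a \<times> 'b \<Rightarrow> real"
  assumes "prob_space \<mu>" "prob_space \<nu>"
    and f [measurable]: "f \<in> borel_measurable (\<mu> \<Otimes>\<^sub>M \<nu>)" and pos: "\<And>z. 0 \<le> f z"
  shows "reg R \<mu> \<nu> (density (\<mu> \<Otimes>\<^sub>M \<nu>) (\<lambda>z. ennreal (f z))) =
    (if integrable (\<mu> \<Otimes>\<^sub>M \<nu>) (\<lambda>z. reg_integrand R (f z))
     then ereal (\<integral>z. reg_integrand R (f z) \<partial>(\<mu> \<Otimes>\<^sub>M \<nu>)) else \<infinity>)"
proof -
  interpret \<mu>: prob_space \<mu> by fact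
  interpret \<nu>: prob_space \<nu> by fact
  interpret M: pair_prob_space \<mu> \<nu> ..
  let ?M = "\<mu> \<Otimes>\<^sub>M \<nu>"
  let ?\<pi> = "density ?M (\<lambda>z. ennreal (f z))"
  have ac: "absolutely_continuous ?M ?\<pi>"
    by (rule absolutely_continuousI_density) measurable
  have RN: "AE z in ?M. ennreal (f z) = RN_deriv ?M ?\<pi> z"
    by (rule M.RN_deriv_unique) auto
  show ?thesis
  proof (cases R)
    case KL
    \<comment> \<open>The base \<open>exp 1\<close> turns \<open>log\<close> into \<open>ln\<close>;
      the factor \<open>f z\<close> comes from integrating against the plan instead of the product
      measure.\<close>
    have ent: "AE z in ?M. f z * entropy_density (exp 1) ?M ?\<pi> z = reg_integrand KL (f z)"
      using RN
    proof eventually_elim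
      case (elim z)
      then have "enn2real (RN_deriv ?M ?\<pi> z) = f z"
        using pos by (metis enn2real_ennreal)
      then show ?case by (simp add: entropy_density_def log_def)
    qed
    have "integrable ?\<pi> (entropy_density (exp 1) ?M ?\<pi>) \<longleftrightarrow>
        integrable ?M (\<lambda>z. f z * entropy_density (exp 1) ?M ?\<pi> z)"
      by (subst integrable_density) (auto simp: pos)
    also have "\<dots> \<longleftrightarrow> integrable ?M (\<lambda>z. reg_integrand KL (f z))"
      using ent by (intro integrable_cong_AE) auto
    finally have int: "integrable ?\<pi> (entropy_density (exp 1) ?M ?\<pi>) \<longleftrightarrow>
        integrable ?M (\<lambda>z. reg_integrand KL (f z))" .
    have "KL_divergence (exp 1) ?M ?\<pi> = (\<integral>z. f z * entropy_density (exp 1) ?M ?\<pi> z \<partial>?M)"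
      unfolding KL_divergence_def by (subst integral_density) (auto simp: pos)
    also have "\<dots> = (\<integral>z. reg_integrand KL (f z) \<partial>?M)"
      using ent by (intro integral_cong_AE) auto
    finally show ?thesis unfolding KL reg.simps using ac int by simp
  next
    case Norm2
    let ?I = "\<integral>\<^sup>+ z. ennreal (reg_integrand Norm2 (f z)) \<partial>?M"
    have "(\<integral>\<^sup>+ z. (RN_deriv ?M ?\<pi> z)\<^sup>2 \<partial>?M) / 2 = (\<integral>\<^sup>+ z. (RN_deriv ?M ?\<pi> z)\<^sup>2 / 2 \<partial>?M)"
      by (subst nn_integral_divide) auto
    also have "\<dots> = ?I"
    proof (rule nn_integral_cong_AE, use RN in eventually_elim)
      case (elim z)
      have "(RN_deriv ?M ?\<pi> z)\<^sup>2 / 2 = (ennreal (f z))\<^sup>2 / ennreal 2"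
        by (simp add: elim)
      also have "\<dots> = ennreal (reg_integrand Norm2 (f z))"
        using pos divide_ennreal[of "(f z)\<^sup>2" 2] by (simp add: ennreal_power)
      finally show ?case .
    qed
    finally have eq: "reg Norm2 \<mu> \<nu> ?\<pi> = enn2ereal ?I" using ac by simp
    have nn: "0 \<le> reg_integrand Norm2 t" for t by simp
    show ?thesis
    proof (cases "integrable ?M (\<lambda>z. reg_integrand Norm2 (f z))")
      case True
      then have "?I = ennreal (\<integral>z. reg_integrand Norm2 (f z) \<partial>?M)"
        by (intro nn_integral_eq_integral) (auto simp del: reg_integrand.simps simp: nn)
      moreover have "0 \<le> (\<integral>z. reg_integrand Norm2 (f z) \<partial>?M)"
        by (intro Bochner_Integration.integral_nonneg nn)
      ultimately show ?thesis
        unfolding Norm2 eq using True by (simp add: enn2ereal_ennreal del: reg_integrand.simps)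
    next
      case False
      have "?I = \<infinity>"
      proof (rule ccontr)
        assume "?I \<noteq> \<infinity>"
        then have "integrable ?M (\<lambda>z. reg_integrand Norm2 (f z))"
          by (intro integrableI_nonneg) (auto simp del: reg_integrand.simps simp: nn top.not_eq_extremum)
        with False show False by simp
      qed
      then show ?thesis unfolding Norm2 eq using False by simp
    qed
  qed
qed

text \<open>A converse to \<open>transport_cost_finite\<close>: integrability makes the positive and
  negative parts both finite, so their extended-real difference is finite.\<close>

lemma transport_cost_integrable:
  assumes c: "integrable \<pi> (\<lambda>(x, y). c x y)"
  shows "transport_cost c \<pi> = ereal (\<integral>(x, y). c x y \<partial>\<pi>)"
proof (rule transport_cost_finite(2))
  let ?P = "\<integral>\<^sup>+ z. ennreal (case z of (x, y) \<Rightarrow> c x y) \<partial>\<pi>"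
  let ?N = "\<integral>\<^sup>+ z. ennreal (- (case z of (x, y) \<Rightarrow> c x y)) \<partial>\<pi>"
  show "(\<lambda>(x, y). c x y) \<in> borel_measurable \<pi>"
    using c by (rule borel_measurable_integrable)
  have eq: "transport_cost c \<pi> = enn2ereal ?P - enn2ereal ?N"
    by (simp add: transport_cost_def case_prod_beta')
  obtain a b where "?P = ennreal a" "0 \<le> a" "?N = ennreal b" "0 \<le> b"
    using c unfolding real_integrable_def by (cases ?P; cases ?N) auto
  then show "\<bar>transport_cost c \<pi>\<bar> \<noteq> \<infinity>"
    unfolding eq by (simp add: enn2ereal_ennreal)
qed

text \<open>Replaces extended-real objectives by ordinary integrals over one fixed reference
  measure, so that objectives of different plans can be added and subtracted.\<close>

lemma rot_objective_density:
  fixes c :: "'a \<Rightarrow> 'b \<Rightarrow> real" and f :: "'a \<times> 'b \<Rightarrow> real"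
  assumes \<mu>\<nu>: "prob_space \<mu>" "prob_space \<nu>" and l: "0 < l"
    and c [measurable]: "(\<lambda>(x, y). c x y) \<in> borel_measurable (\<mu> \<Otimes>\<^sub>M \<nu>)"
    and f [measurable]: "f \<in> borel_measurable (\<mu> \<Otimes>\<^sub>M \<nu>)" and pos: "\<And>z. 0 \<le> f z"
  defines "\<pi> \<equiv> density (\<mu> \<Otimes>\<^sub>M \<nu>) (\<lambda>z. ennreal (f z))"
  shows "\<bar>rot_objective c R l \<mu> \<nu> \<pi>\<bar> \<noteq> \<infinity> \<Longrightarrow>
      integrable (\<mu> \<Otimes>\<^sub>M \<nu>) (\<lambda>z. f z * case_prod c z)"
    and "\<bar>rot_objective c R l \<mu> \<nu> \<pi>\<bar> \<noteq> \<infinity> \<Longrightarrow>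
      integrable (\<mu> \<Otimes>\<^sub>M \<nu>) (\<lambda>z. reg_integrand R (f z))"
    and "integrable (\<mu> \<Otimes>\<^sub>M \<nu>) (\<lambda>z. f z * case_prod c z) \<Longrightarrow>
      integrable (\<mu> \<Otimes>\<^sub>M \<nu>) (\<lambda>z. reg_integrand R (f z)) \<Longrightarrow>
      rot_objective c R l \<mu> \<nu> \<pi> =
      ereal (\<integral>z. f z * case_prod c z + l * reg_integrand R (f z) \<partial>(\<mu> \<Otimes>\<^sub>M \<nu>))"
proof -
  let ?M = "\<mu> \<Otimes>\<^sub>M \<nu>"
  note reg = reg_density[OF \<mu>\<nu> f pos, of R, folded \<pi>_def]
  have int: "integrable \<pi> (\<lambda>(x, y). c x y) \<longleftrightarrow> integrable ?M (\<lambda>z. f z * case_prod c z)"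
    unfolding \<pi>_def by (subst integrable_density) (auto simp: pos)
  have eq: "(\<integral>(x, y). c x y \<partial>\<pi>) = (\<integral>z. f z * case_prod c z \<partial>?M)"
    unfolding \<pi>_def by (subst integral_density) (auto simp: pos)
  {
    assume fin: "\<bar>rot_objective c R l \<mu> \<nu> \<pi>\<bar> \<noteq> \<infinity>"
    \<comment> \<open>In \<open>ereal\<close>, a sum is finite only if both summands are, since
      \<open>\<infinity>\<close> plus its negative is \<open>\<infinity>\<close>.\<close>
    then have tc: "\<bar>transport_cost c \<pi>\<bar> \<noteq> \<infinity>"
      and lr: "\<bar>ereal l * reg R \<mu> \<nu> \<pi>\<bar> \<noteq> \<infinity>"
      unfolding rot_objective_def
      by (cases "transport_cost c \<pi>"; cases "ereal l * reg R \<mu> \<nu> \<pi>"; simp)+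
    have "(\<lambda>(x, y). c x y) \<in> borel_measurable \<pi>"
      unfolding \<pi>_def by simp
    then have "integrable \<pi> (\<lambda>(x, y). c x y)"
      using tc by (rule transport_cost_finite(1))
    then show "integrable ?M (\<lambda>z. f z * case_prod c z)"
      by (simp only: int)
    \<comment> \<open>Here \<open>l\<close> must be nonzero, because
      \<open>0 * \<infinity> = 0\<close> in \<open>ereal\<close>.\<close>
    have "reg R \<mu> \<nu> \<pi> \<noteq> \<infinity>" using lr l by auto
    then show "integrable ?M (\<lambda>z. reg_integrand R (f z))"
      unfolding reg by meson
  }
  assume i: "integrable ?M (\<lambda>z. f z * case_prod c z)" "integrable ?M (\<lambda>z. reg_integrand R (f z))"
  then have "transport_cost c \<pi> = ereal (\<integral>z. f z * case_prod c z \<partial>?M)"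
    using transport_cost_integrable[of \<pi> c] by (simp only: int eq)
  then show "rot_objective c R l \<mu> \<nu> \<pi> =
      ereal (\<integral>z. f z * case_prod c z + l * reg_integrand R (f z) \<partial>?M)"
    unfolding rot_objective_def reg using i by simp
qed

section \<open>Uniqueness of the optimal plan\<close>

text \<open>The measure with the averaged density is the average of the two measures. Total mass and
  marginals prescribe the values on certain sets, and averaging preserves every value on which the
  two plans agree.\<close>

lemma couplings_midpoint:
  fixes f g :: "'a \<times> 'b \<Rightarrow> real"
  assumes f [measurable]: "f \<in> borel_measurable (\<mu> \<Otimes>\<^sub>M \<nu>)"
    and g [measurable]: "g \<in> borel_measurable (\<mu> \<Otimes>\<^sub>M \<nu>)"
    and pos: "\<And>z. 0 \<le> f z" "\<And>z. 0 \<le> g z"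
    and cpl: "density (\<mu> \<Otimes>\<^sub>M \<nu>) (\<lambda>z. ennreal (f z)) \<in> couplings \<mu> \<nu>"
      "density (\<mu> \<Otimes>\<^sub>M \<nu>) (\<lambda>z. ennreal (g z)) \<in> couplings \<mu> \<nu>"
  shows "density (\<mu> \<Otimes>\<^sub>M \<nu>) (\<lambda>z. ennreal ((f z + g z) / 2)) \<in> couplings \<mu> \<nu>"
proof -
  let ?M = "\<mu> \<Otimes>\<^sub>M \<nu>"
  let ?f = "density ?M (\<lambda>z. ennreal (f z))" and ?g = "density ?M (\<lambda>z. ennreal (g z))"
    and ?h = "density ?M (\<lambda>z. ennreal ((f z + g z) / 2))"
  have em: "emeasure ?h A = (emeasure ?f A + emeasure ?g A) / 2" if [measurable]: "A \<in> sets ?M" for A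
  proof -
    have "ennreal ((f z + g z) / 2) * indicator A z =
        (ennreal (f z) * indicator A z + ennreal (g z) * indicator A z) / 2" for z
      using divide_ennreal[of "f z + g z" 2] pos by (simp split: split_indicator)
    then have "emeasure ?h A =
        (\<integral>\<^sup>+ z. (ennreal (f z) * indicator A z + ennreal (g z) * indicator A z) / 2 \<partial>?M)"
      by (simp add: emeasure_density)
    also have "\<dots> = (emeasure ?f A + emeasure ?g A) / 2"
      by (simp add: nn_integral_divide nn_integral_add emeasure_density)
    finally show ?thesis .
  qed
  have half: "(a + a) / 2 = a" for a :: ennreal
  proof (cases a)
    case (real r)
    then show ?thesis using divide_ennreal[of "r + r" 2] by (simp flip: ennreal_plus)
  qed (simp add: ennreal_top_divide)
  have em': "emeasure ?h A = a" if "A \<in> sets ?M" "emeasure ?f A = a" "emeasure ?g A = a" for A a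
    using em[OF that(1)] that half by simp
  from cpl have fg: "prob_space ?f" "prob_space ?g" "distr ?f \<mu> fst = \<mu>" "distr ?g \<mu> fst = \<mu>"
      "distr ?f \<nu> snd = \<nu>" "distr ?g \<nu> snd = \<nu>"
    by (auto simp: couplings_def)
  have "prob_space ?h"
    using fg(1,2)[THEN prob_space.emeasure_space_1] by (intro prob_spaceI) (auto intro!: em')
  moreover have "distr ?h \<mu> fst = \<mu>"
  proof (rule measure_eqI)
    fix A assume "A \<in> sets (distr ?h \<mu> fst)"
    then have [measurable]: "A \<in> sets \<mu>" by simp
    have "emeasure (distr ?f \<mu> fst) A = emeasure \<mu> A" "emeasure (distr ?g \<mu> fst) A = emeasure \<mu> A"
      using fg by simp_all
    then show "emeasure (distr ?h \<mu> fst) A = emeasure \<mu> A"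
      by (simp add: emeasure_distr em')
  qed simp
  moreover have "distr ?h \<nu> snd = \<nu>"
  proof (rule measure_eqI)
    fix A assume "A \<in> sets (distr ?h \<nu> snd)"
    then have [measurable]: "A \<in> sets \<nu>" by simp
    have "emeasure (distr ?f \<nu> snd) A = emeasure \<nu> A" "emeasure (distr ?g \<nu> snd) A = emeasure \<nu> A"
      using fg by simp_all
    then show "emeasure (distr ?h \<nu> snd) A = emeasure \<nu> A"
      by (simp add: emeasure_distr em')
  qed simp
  ultimately show ?thesis by (simp add: couplings_def)
qed

text \<open>An optimal plan has finite objective, hence a regularizer value other than
  \<open>\<infinity>\<close>, and both regularizers are infinite off absolute continuity.\<close>

lemma is_optimal_plan_density:
  fixes c :: "'a \<Rightarrow> 'b \<Rightarrow> real"
  assumes "prob_space \<mu>" "prob_space \<nu>" "0 < l" and opt: "is_optimal_plan c R l \<mu> \<nu> \<pi>"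
  obtains f :: "'a \<times> 'b \<Rightarrow> real" where "f \<in> borel_measurable (\<mu> \<Otimes>\<^sub>M \<nu>)" "\<And>z. 0 \<le> f z"
    "\<pi> = density (\<mu> \<Otimes>\<^sub>M \<nu>) (\<lambda>z. ennreal (f z))"
proof -
  have "reg R \<mu> \<nu> \<pi> \<noteq> \<infinity>"
    using opt \<open>0 < l\<close> by (auto simp: is_optimal_plan_def rot_objective_def)
  then have "absolutely_continuous (\<mu> \<Otimes>\<^sub>M \<nu>) \<pi>"
    by (cases R) (auto split: if_splits)
  moreover have "prob_space \<pi>" "sets \<pi> = sets (\<mu> \<Otimes>\<^sub>M \<nu>)"
    using opt by (auto simp: is_optimal_plan_def couplings_def)
  ultimately show thesis
    using absolutely_continuous_density_real assms that by blast
qed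

text \<open>The strict improvement is carried out in integrated form: the convexity gap of the two
  densities is nonnegative with integral at most 0, so it vanishes almost everywhere, and strict
  convexity makes the densities agree. Existence of a minimizer is not claimed.\<close>

lemma is_optimal_plan_unique:
  fixes c :: "'a \<Rightarrow> 'b \<Rightarrow> real"
  assumes \<mu>\<nu>: "prob_space \<mu>" "prob_space \<nu>" and l: "0 < l"
    and c [measurable]: "(\<lambda>(x, y). c x y) \<in> borel_measurable (\<mu> \<Otimes>\<^sub>M \<nu>)"
    and opt: "is_optimal_plan c R l \<mu> \<nu> \<pi>" "is_optimal_plan c R l \<mu> \<nu> \<pi>'"
  shows "\<pi> = \<pi>'"
proof -
  interpret \<mu>: prob_space \<mu> by fact
  interpret \<nu>: prob_space \<nu> by fact
  interpret M: pair_prob_space \<mu> \<nu> ..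
  let ?M = "\<mu> \<Otimes>\<^sub>M \<nu>"
  let ?r = "reg_integrand R"
  obtain f where f [measurable]: "f \<in> borel_measurable ?M" and f0: "\<And>z. 0 \<le> f z"
    and \<pi>: "\<pi> = density ?M (\<lambda>z. ennreal (f z))"
    using is_optimal_plan_density[OF \<mu>\<nu> l opt(1)] by blast
  obtain g where g [measurable]: "g \<in> borel_measurable ?M" and g0: "\<And>z. 0 \<le> g z"
    and \<pi>': "\<pi>' = density ?M (\<lambda>z. ennreal (g z))"
    using is_optimal_plan_density[OF \<mu>\<nu> l opt(2)] by blast
  define h where "h z = (f z + g z) / 2" for z
  have h [measurable]: "h \<in> borel_measurable ?M" unfolding h_def by measurable
  have h0: "0 \<le> h z" for z using f0 g0 by (simp add: h_def)
  let ?\<rho> = "density ?M (\<lambda>z. ennreal (h z))"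
  have \<rho>: "?\<rho> \<in> couplings \<mu> \<nu>"
    using opt couplings_midpoint[OF f g f0 g0] unfolding \<pi> \<pi>' is_optimal_plan_def h_def by auto
  note objf = rot_objective_density[OF \<mu>\<nu> l c f f0, of R, folded \<pi>]
  note objg = rot_objective_density[OF \<mu>\<nu> l c g g0, of R, folded \<pi>']
  note objh = rot_objective_density[OF \<mu>\<nu> l c h h0, of R]
  have fin: "\<bar>rot_objective c R l \<mu> \<nu> \<pi>\<bar> \<noteq> \<infinity>" "\<bar>rot_objective c R l \<mu> \<nu> \<pi>'\<bar> \<noteq> \<infinity>"
    using opt by (auto simp: is_optimal_plan_def)
  note intf [simp] = objf(1,2)[OF fin(1)] and intg [simp] = objg(1,2)[OF fin(2)]
  have hc: "h z * case_prod c z = (f z * case_prod c z + g z * case_prod c z) / 2" for z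
    by (simp add: h_def algebra_simps add_divide_distrib)
  have inth1 [simp]: "integrable ?M (\<lambda>z. h z * case_prod c z)"
    unfolding hc by simp
  have mid: "?r (h z) \<le> (?r (f z) + ?r (g z)) / 2" for z
    unfolding h_def by (rule reg_integrand_midpoint_le[OF f0 g0])
  \<comment> \<open>The midpoint value lies between -1 and the average of two integrable functions.
    This makes the objective of the midpoint plan a real integral.\<close>
  have inth2 [simp]: "integrable ?M (\<lambda>z. ?r (h z))"
  proof (rule Bochner_Integration.integrable_bound)
    show "integrable ?M (\<lambda>z. \<bar>(?r (f z) + ?r (g z)) / 2\<bar> + 1)" by simp
    have "\<bar>?r (h z)\<bar> \<le> \<bar>(?r (f z) + ?r (g z)) / 2\<bar> + 1" for z
      using mid[of z] reg_integrand_ge[OF h0[of z], of R] by linarith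
    then show "AE z in ?M. norm (?r (h z)) \<le> norm (\<bar>(?r (f z) + ?r (g z)) / 2\<bar> + 1)"
      by (intro AE_I2) (simp add: abs_of_nonneg)
  qed measurable
  let ?F = "\<lambda>f z. f z * case_prod c z + l * ?r (f z)"
  let ?d = "\<lambda>z. (?r (f z) + ?r (g z)) / 2 - ?r (h z)"
  have le: "(\<integral>z. ?F f z \<partial>?M) \<le> (\<integral>z. ?F h z \<partial>?M)" "(\<integral>z. ?F g z \<partial>?M) \<le> (\<integral>z. ?F h z \<partial>?M)"
    using opt \<rho> objf(3) objg(3) objh(3) by (auto simp: is_optimal_plan_def)
  \<comment> \<open>The transport term is linear in the density and cancels, leaving only the
    convexity gap \<open>?d\<close> of the regularizer.\<close>
  have "(\<integral>z. ?F f z \<partial>?M) + (\<integral>z. ?F g z \<partial>?M) - 2 * (\<integral>z. ?F h z \<partial>?M)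
      = (\<integral>z. ?F f z + ?F g z - 2 * ?F h z \<partial>?M)"
    by simp
  also have "\<dots> = (\<integral>z. 2 * l * ?d z \<partial>?M)"
    by (intro Bochner_Integration.integral_cong) (auto simp: h_def field_simps)
  also have "\<dots> = 2 * l * (\<integral>z. ?d z \<partial>?M)"
    by (rule integral_mult_right_zero)
  \<comment> \<open>Each of the two minimizers does at least as well as the midpoint plan, which is
    a competitor by \<open>\<rho>\<close>.\<close>
  finally have "2 * l * (\<integral>z. ?d z \<partial>?M) \<le> 0"
    using le by linarith
  then have "(\<integral>z. ?d z \<partial>?M) \<le> 0"
    using l by (simp add: mult_le_0_iff)
  moreover have d0: "0 \<le> ?d z" for z using mid[of z] by simp
  then have "0 \<le> (\<integral>z. ?d z \<partial>?M)"
    by (rule Bochner_Integration.integral_nonneg)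
  ultimately have "(\<integral>z. ?d z \<partial>?M) = 0" by linarith
  moreover have "integrable ?M ?d" by simp
  ultimately have "AE z in ?M. ?d z = 0"
    using d0 integral_nonneg_eq_0_iff_AE[of ?M ?d] by blast
  then have "AE z in ?M. ennreal (f z) = ennreal (g z)"
  proof eventually_elim
    case (elim z)
    then show ?case
      using reg_integrand_midpoint_less[OF f0 g0, of z z R] unfolding h_def by force
  qed
  then show ?thesis unfolding \<pi> \<pi>' by (intro density_cong) auto
qed

section \<open>Swapping coordinates and symmetry of the sharp cost\<close>

definition swap_plan :: "'a measure \<Rightarrow> 'b measure \<Rightarrow> ('a \<times> 'b) measure \<Rightarrow> ('b \<times> 'a) measure" where
  "swap_plan \<mu> \<nu> \<pi> = distr \<pi> (\<nu> \<Otimes>\<^sub>M \<mu>) (\<lambda>z. (snd z, fst z))"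

lemma sets_swap_plan [simp, measurable_cong]: "sets (swap_plan \<mu> \<nu> \<pi>) = sets (\<nu> \<Otimes>\<^sub>M \<mu>)"
  by (simp add: swap_plan_def)

lemma measurable_swap_sets:
  "sets \<pi> = sets (\<mu> \<Otimes>\<^sub>M \<nu>) \<Longrightarrow> (\<lambda>z. (snd z, fst z)) \<in> \<pi> \<rightarrow>\<^sub>M \<nu> \<Otimes>\<^sub>M \<mu>"
  by (simp cong: measurable_cong_sets)

text \<open>Being an involution makes the swap a bijection between couplings of the two orders, so
  facts proved in one direction transfer back.\<close>

lemma swap_plan_swap_plan:
  assumes "sets \<pi> = sets (\<mu> \<Otimes>\<^sub>M \<nu>)"
  shows "swap_plan \<nu> \<mu> (swap_plan \<mu> \<nu> \<pi>) = \<pi>"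
proof -
  have "swap_plan \<nu> \<mu> (swap_plan \<mu> \<nu> \<pi>) = distr \<pi> (\<mu> \<Otimes>\<^sub>M \<nu>) (\<lambda>z. z)"
    unfolding swap_plan_def
    by (subst distr_distr) (simp_all add: measurable_swap_sets[OF assms] comp_def)
  also have "\<dots> = \<pi>"
    using assms by (intro distr_id2) simp
  finally show ?thesis .
qed

lemma swap_plan_couplings:
  assumes "\<pi> \<in> couplings \<mu> \<nu>"
  shows "swap_plan \<mu> \<nu> \<pi> \<in> couplings \<nu> \<mu>"
proof -
  have \<pi>: "prob_space \<pi>" "sets \<pi> = sets (\<mu> \<Otimes>\<^sub>M \<nu>)" "distr \<pi> \<mu> fst = \<mu>" "distr \<pi> \<nu> snd = \<nu>"
    using assms by (auto simp: couplings_def)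
  note [measurable] = measurable_swap_sets[OF \<pi>(2)]
  have "prob_space (swap_plan \<mu> \<nu> \<pi>)"
    unfolding swap_plan_def by (rule prob_space.prob_space_distr[OF \<pi>(1)]) measurable
  moreover have "distr (swap_plan \<mu> \<nu> \<pi>) \<nu> fst = distr \<pi> \<nu> snd"
    unfolding swap_plan_def by (subst distr_distr) (simp_all add: comp_def)
  moreover have "distr (swap_plan \<mu> \<nu> \<pi>) \<mu> snd = distr \<pi> \<mu> fst"
    unfolding swap_plan_def by (subst distr_distr) (simp_all add: comp_def)
  ultimately show ?thesis using \<pi> by (simp add: couplings_def)
qed

lemma swap_plan_density:
  assumes "prob_space \<mu>" "prob_space \<nu>"
    and f: "f \<in> borel_measurable (\<mu> \<Otimes>\<^sub>M \<nu>)"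
  shows "swap_plan \<mu> \<nu> (density (\<mu> \<Otimes>\<^sub>M \<nu>) f) = density (\<nu> \<Otimes>\<^sub>M \<mu>) (\<lambda>(y, x). f (x, y))"
proof -
  interpret \<mu>: prob_space \<mu> by fact
  interpret \<nu>: prob_space \<nu> by fact
  interpret M: pair_prob_space \<mu> \<nu> ..
  \<comment> \<open>The product measure is written as the image of the reversed product, so that the
    outer swap undoes the inner one in \<open>distr_density_distr\<close>.\<close>
  have "swap_plan \<mu> \<nu> (density (\<mu> \<Otimes>\<^sub>M \<nu>) f) =
      distr (density (distr (\<nu> \<Otimes>\<^sub>M \<mu>) (\<mu> \<Otimes>\<^sub>M \<nu>) (\<lambda>z. (snd z, fst z))) f)
        (\<nu> \<Otimes>\<^sub>M \<mu>) (\<lambda>z. (snd z, fst z))"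
    unfolding swap_plan_def using M.distr_pair_swap by (simp add: case_prod_beta')
  also have "\<dots> = density (\<nu> \<Otimes>\<^sub>M \<mu>) (f \<circ> (\<lambda>z. (snd z, fst z)))"
    using f by (intro distr_density_distr) auto
  finally show ?thesis by (simp add: comp_def case_prod_beta')
qed

text \<open>The swapped plan has the swapped density, and swapping the factors of a product measure
  preserves integrals. The second claim serves to handle plans that are not absolutely
  continuous.\<close>

lemma reg_swap_plan:
  assumes \<mu>\<nu>: "prob_space \<mu>" "prob_space \<nu>" and \<pi>: "prob_space \<pi>" "sets \<pi> = sets (\<mu> \<Otimes>\<^sub>M \<nu>)"
    and ac: "absolutely_continuous (\<mu> \<Otimes>\<^sub>M \<nu>) \<pi>"
  shows "reg R \<nu> \<mu> (swap_plan \<mu> \<nu> \<pi>) = reg R \<mu> \<nu> \<pi>"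
    and "absolutely_continuous (\<nu> \<Otimes>\<^sub>M \<mu>) (swap_plan \<mu> \<nu> \<pi>)"
proof -
  interpret \<mu>: prob_space \<mu> by fact
  interpret \<nu>: prob_space \<nu> by fact
  interpret M: pair_prob_space \<mu> \<nu> ..
  obtain f where f [measurable]: "f \<in> borel_measurable (\<mu> \<Otimes>\<^sub>M \<nu>)" and f0: "\<And>z. 0 \<le> f z"
    and eq: "\<pi> = density (\<mu> \<Otimes>\<^sub>M \<nu>) (\<lambda>z. ennreal (f z))"
    using absolutely_continuous_density_real[OF \<mu>\<nu> \<pi> ac] by blast
  let ?g = "\<lambda>z. f (snd z, fst z)"
  have sw: "swap_plan \<mu> \<nu> \<pi> = density (\<nu> \<Otimes>\<^sub>M \<mu>) (\<lambda>z. ennreal (?g z))"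
    unfolding eq by (subst swap_plan_density[OF \<mu>\<nu>]) (auto simp: case_prod_beta')
  have g [measurable]: "?g \<in> borel_measurable (\<nu> \<Otimes>\<^sub>M \<mu>)" by measurable
  show "absolutely_continuous (\<nu> \<Otimes>\<^sub>M \<mu>) (swap_plan \<mu> \<nu> \<pi>)"
    unfolding sw by (rule absolutely_continuousI_density) measurable
  have "integrable (\<nu> \<Otimes>\<^sub>M \<mu>) (\<lambda>z. reg_integrand R (?g z)) \<longleftrightarrow>
      integrable (\<mu> \<Otimes>\<^sub>M \<nu>) (\<lambda>z. reg_integrand R (f z))"
    using M.integrable_product_swap_iff[of "\<lambda>z. reg_integrand R (f z)"] by (simp add: case_prod_beta')
  moreover have "(\<integral>z. reg_integrand R (?g z) \<partial>(\<nu> \<Otimes>\<^sub>M \<mu>)) = (\<integral>z. reg_integrand R (f z) \<partial>(\<mu> \<Otimes>\<^sub>M \<nu>))"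
    using M.integral_product_swap[of "\<lambda>z. reg_integrand R (f z)"] by (simp add: case_prod_beta')
  ultimately show "reg R \<nu> \<mu> (swap_plan \<mu> \<nu> \<pi>) = reg R \<mu> \<nu> \<pi>"
    unfolding sw
    by (simp add: eq reg_density[OF \<mu>\<nu> f f0] reg_density[OF \<mu>\<nu>(2,1) g f0])
qed

text \<open>Stated for the flipped cost, so that symmetry of \<open>c\<close> enters only in
  \<open>sharp_cost_commute\<close>.\<close>

lemma rot_objective_swap_plan:
  assumes \<mu>\<nu>: "prob_space \<mu>" "prob_space \<nu>" and cpl: "\<pi> \<in> couplings \<mu> \<nu>"
    and c [measurable]: "(\<lambda>(x, y). c x y) \<in> borel_measurable (\<mu> \<Otimes>\<^sub>M \<nu>)"
  shows "rot_objective (\<lambda>y x. c x y) R l \<nu> \<mu> (swap_plan \<mu> \<nu> \<pi>) = rot_objective c R l \<mu> \<nu> \<pi>"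
proof -
  let ?\<sigma> = "swap_plan \<mu> \<nu> \<pi>"
  have \<pi>: "prob_space \<pi>" "sets \<pi> = sets (\<mu> \<Otimes>\<^sub>M \<nu>)"
    using cpl by (auto simp: couplings_def)
  have \<sigma>: "prob_space ?\<sigma>" "sets ?\<sigma> = sets (\<nu> \<Otimes>\<^sub>M \<mu>)"
    using swap_plan_couplings[OF cpl] by (auto simp: couplings_def)
  have reg: "reg R \<nu> \<mu> ?\<sigma> = reg R \<mu> \<nu> \<pi>"
  proof (cases "absolutely_continuous (\<mu> \<Otimes>\<^sub>M \<nu>) \<pi>")
    case True
    then show ?thesis by (rule reg_swap_plan(1)[OF \<mu>\<nu> \<pi>])
  next
    case False
    \<comment> \<open>Otherwise swapping back would make \<open>\<pi>\<close> absolutely continuous.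
      So both regularizer values are infinite.\<close>
    then have "\<not> absolutely_continuous (\<nu> \<Otimes>\<^sub>M \<mu>) ?\<sigma>"
      using reg_swap_plan(2)[OF \<mu>\<nu>(2,1) \<sigma>] swap_plan_swap_plan[OF \<pi>(2)] by auto
    with False show ?thesis by (cases R) auto
  qed
  note [measurable] = measurable_swap_sets[OF \<pi>(2)]
  have c' [measurable]: "(\<lambda>z. c (snd z) (fst z)) \<in> borel_measurable (\<nu> \<Otimes>\<^sub>M \<mu>)"
    using measurable_compose[OF measurable_pair_swap' c] by (simp add: case_prod_beta')
  have "transport_cost (\<lambda>y x. c x y) ?\<sigma> = transport_cost c \<pi>"
    unfolding transport_cost_def swap_plan_def case_prod_beta'
    using measurable_swap_sets[OF \<pi>(2)]
    by (subst (1 2) nn_integral_distr) (auto simp: case_prod_beta')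
  with reg show ?thesis by (simp add: rot_objective_def)
qed

text \<open>A competitor for the reversed problem is swapped back and compared with
  \<open>\<pi>\<close> there; both swaps preserve the objective.\<close>

lemma is_optimal_plan_swap_plan:
  assumes \<mu>\<nu>: "prob_space \<mu>" "prob_space \<nu>"
    and c [measurable]: "(\<lambda>(x, y). c x y) \<in> borel_measurable (\<mu> \<Otimes>\<^sub>M \<nu>)"
    and opt: "is_optimal_plan c R l \<mu> \<nu> \<pi>"
  shows "is_optimal_plan (\<lambda>y x. c x y) R l \<nu> \<mu> (swap_plan \<mu> \<nu> \<pi>)"
proof -
  note swap = rot_objective_swap_plan[OF \<mu>\<nu> _ c, of _ R l]
  have "rot_objective c R l \<mu> \<nu> \<pi> \<le> rot_objective (\<lambda>y x. c x y) R l \<nu> \<mu> \<sigma>"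
    if \<sigma>: "\<sigma> \<in> couplings \<nu> \<mu>" for \<sigma>
  proof -
    have "rot_objective c R l \<mu> \<nu> \<pi> \<le> rot_objective c R l \<mu> \<nu> (swap_plan \<nu> \<mu> \<sigma>)"
      using opt swap_plan_couplings[OF \<sigma>] by (simp add: is_optimal_plan_def)
    also have "\<dots> = rot_objective (\<lambda>y x. c x y) R l \<nu> \<mu> \<sigma>"
      using swap[OF swap_plan_couplings[OF \<sigma>]] \<sigma>
      by (simp add: swap_plan_swap_plan couplings_def)
    finally show ?thesis .
  qed
  then show ?thesis
    using opt swap[of \<pi>] swap_plan_couplings[of \<pi> \<mu> \<nu>] by (simp add: is_optimal_plan_def)
qed

text \<open>Uniqueness evaluates the definite description in \<open>optimal_plan\<close> on both
  sides. Existence is not assumed, hence the case distinction.\<close>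

lemma sharp_cost_commute:
  fixes c :: "'a \<Rightarrow> 'a \<Rightarrow> real"
  assumes \<mu>\<nu>: "prob_space \<mu>" "prob_space \<nu>" and l: "0 < l"
    and c: "(\<lambda>(x, y). c x y) \<in> borel_measurable (\<mu> \<Otimes>\<^sub>M \<nu>)"
    and sym: "\<And>x y. c x y = c y x"
  shows "sharp_cost c R l \<mu> \<nu> = sharp_cost c R l \<nu> \<mu>"
proof -
  have c': "(\<lambda>(x, y). c x y) \<in> borel_measurable (\<nu> \<Otimes>\<^sub>M \<mu>)"
    using measurable_compose[OF measurable_pair_swap' c] by (simp add: case_prod_beta' sym)
  have c_swap: "(\<lambda>y x. c x y) = c" using sym by blast
  show ?thesis
  proof (cases "\<exists>\<pi>. is_optimal_plan c R l \<mu> \<nu> \<pi>")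
    case True
    then obtain \<pi> where \<pi>: "is_optimal_plan c R l \<mu> \<nu> \<pi>" ..
    have \<sigma>: "is_optimal_plan c R l \<nu> \<mu> (swap_plan \<mu> \<nu> \<pi>)"
      using is_optimal_plan_swap_plan[OF \<mu>\<nu> c \<pi>] by (simp only: c_swap)
    have "optimal_plan c R l \<mu> \<nu> = \<pi>"
      unfolding optimal_plan_def
      using \<pi> is_optimal_plan_unique[OF \<mu>\<nu> l c] by (intro the_equality) auto
    moreover have "optimal_plan c R l \<nu> \<mu> = swap_plan \<mu> \<nu> \<pi>"
      unfolding optimal_plan_def
      using \<sigma> is_optimal_plan_unique[OF \<mu>\<nu>(2,1) l c'] by (intro the_equality) auto
    moreover have "(\<integral>(x, y). c x y \<partial>(swap_plan \<mu> \<nu> \<pi>)) = (\<integral>(x, y). c x y \<partial>\<pi>)"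
    proof -
      have "sets \<pi> = sets (\<mu> \<Otimes>\<^sub>M \<nu>)"
        using \<pi> by (auto simp: is_optimal_plan_def couplings_def)
      then show ?thesis
        unfolding swap_plan_def using c'
        by (subst integral_distr) (auto simp: measurable_swap_sets case_prod_beta' sym)
    qed
    ultimately show ?thesis by (simp add: sharp_cost_def)
  next
    case False
    (* Without minimizers both plans are the same junk value, THE of the empty predicate. *)
    have "\<not> is_optimal_plan c R l \<nu> \<mu> \<pi>" for \<pi>
      using is_optimal_plan_swap_plan[OF \<mu>\<nu>(2,1) c', of R l \<pi>] False unfolding c_swap by blast
    with False have "is_optimal_plan c R l \<mu> \<nu> = is_optimal_plan c R l \<nu> \<mu>" by blast
    then show ?thesis by (simp add: sharp_cost_def optimal_plan_def)
  qed
qed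

section \<open>Stationarity at the diagonal\<close>

lemma has_derivative_symmetric_diagonal:
  fixes F :: "'a::real_normed_vector \<times> 'a \<Rightarrow> real"
  assumes "open S" "a \<in> S" and sym: "\<And>x y. x \<in> S \<Longrightarrow> y \<in> S \<Longrightarrow> F (x, y) = F (y, x)"
    and F: "F differentiable (at (a, a))"
  shows "((\<lambda>x. 2 * F (x, a) - F (x, x)) has_derivative (\<lambda>h. 0)) (at a)"
proof -
  obtain D where D: "(F has_derivative D) (at (a, a))"
    using F by (auto simp: differentiable_def)
  have "((\<lambda>z. F (snd z, fst z)) has_derivative (\<lambda>h. D (snd h, fst h))) (at (a, a))"
    by (rule has_derivative_compose[where g = F]) (auto intro!: derivative_eq_intros D)
  \<comment> \<open>The swapped function agrees with \<open>F\<close> on the open neighbourhood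
    \<open>S \<times> S\<close> of the diagonal point, and derivatives are local; uniqueness of the
    derivative then makes \<open>D\<close> swap-invariant.\<close>
  then have "(F has_derivative (\<lambda>h. D (snd h, fst h))) (at (a, a))"
    using assms(1,2)
    by (elim has_derivative_transform_within_open[where s = "S \<times> S"])
       (auto simp: sym intro: open_Times)
  then have D_sym: "D = (\<lambda>h. D (snd h, fst h))"
    by (rule has_derivative_unique[OF D])
  interpret D: bounded_linear D using D by (rule has_derivative_bounded_linear)
  have eq: "2 * D (h, 0) - D (h, h) = 0" for h
  proof -
    have "D (h, h) = D (h, 0) + D (0, h)" using D.add[of "(h, 0)" "(0, h)"] by simp
    moreover have "D (0, h) = D (h, 0)" by (subst D_sym) simp
    ultimately show ?thesis by simp
  qed
  have "((\<lambda>x. F (x, a)) has_derivative (\<lambda>h. D (h, 0))) (at a)"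
    "((\<lambda>x. F (x, x)) has_derivative (\<lambda>h. D (h, h))) (at a)"
    by (rule has_derivative_compose[where g = F]; auto intro!: derivative_eq_intros D)+
  then have "((\<lambda>x. 2 * F (x, a) - F (x, x)) has_derivative (\<lambda>h. 2 * D (h, 0) - D (h, h))) (at a)"
    by (intro has_derivative_diff has_derivative_mult_right)
  then show ?thesis by (simp only: eq)
qed

theorem lemma4p3:
  fixes c :: "real ^ 'd \<Rightarrow> real ^ 'd \<Rightarrow> real"
    and R :: regularizer
    and l :: real
    and p :: "'x measure"
    and q :: "(real ^ 'd) measure"
    and \<Theta> :: "'t::euclidean_space set"
    and \<theta>\<^sub>0 :: 't
    and G :: "'t \<Rightarrow> 'x \<Rightarrow> real ^ 'd"
  assumes c_diff: "(\<lambda>(x, y). c x y) differentiable_on UNIV"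
    and c_sym: "\<And>x y. c x y = c y x"
    and p_prob: "prob_space p"
    and open_\<Theta>: "open \<Theta>"
    and G_meas: "\<And>\<theta>. \<theta> \<in> \<Theta> \<Longrightarrow> G \<theta> \<in> p \<rightarrow>\<^sub>M borel"
    and G_inj: "\<And>\<theta>. \<theta> \<in> \<Theta> \<Longrightarrow> inj_on (G \<theta>) (space p)"
    and G_diff: "\<And>x. x \<in> space p \<Longrightarrow> (\<lambda>\<theta>. G \<theta> x) differentiable_on \<Theta>"
    and l_pos: "l > 0"
    and cost_diff: "(\<lambda>(\<theta>, \<theta>'). sharp_cost c R l (distr p borel (G \<theta>)) (distr p borel (G \<theta>')))
                      differentiable_on \<Theta> \<times> \<Theta>"
    and \<theta>\<^sub>0: "\<theta>\<^sub>0 \<in> \<Theta>"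
    and q: "q = distr p borel (G \<theta>\<^sub>0)"
  shows "GDERIV (\<lambda>\<theta>. sinkhorn_loss c R l (distr p borel (G \<theta>)) q) \<theta>\<^sub>0 :> 0 \<and>
         sinkhorn_loss c R l (distr p borel (G \<theta>\<^sub>0)) q = 0"
proof
  let ?P = "\<lambda>\<theta>. distr p borel (G \<theta>)"
  let ?F = "\<lambda>(\<theta>, \<theta>'). sharp_cost c R l (?P \<theta>) (?P \<theta>')"
  \<comment> \<open>Differentiability of \<open>c\<close> yields Borel measurability on the product
    space, whose Borel sets are those of the product sigma-algebra by
    \<open>borel_prod\<close>.\<close>
  have "continuous_on UNIV (\<lambda>(x, y). c x y)"
    using c_diff by (rule differentiable_imp_continuous_on)
  then have "(\<lambda>(x, y). c x y) \<in> borel_measurable borel"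
    by (rule borel_measurable_continuous_onI)
  then have c_meas: "(\<lambda>(x, y). c x y) \<in> borel_measurable (?P \<theta> \<Otimes>\<^sub>M ?P \<theta>')" for \<theta> \<theta>'
  proof -
    have "sets (?P \<theta> \<Otimes>\<^sub>M ?P \<theta>') = sets (borel \<Otimes>\<^sub>M borel)"
      by (intro sets_pair_measure_cong) simp_all
    then have "sets (?P \<theta> \<Otimes>\<^sub>M ?P \<theta>') = sets borel"
      by (simp only: borel_prod)
    from measurable_cong_sets[OF this refl] show ?thesis
      using \<open>_ \<in> borel_measurable borel\<close> by blast
  qed
  have "?F (\<theta>, \<theta>') = ?F (\<theta>', \<theta>)" if "\<theta> \<in> \<Theta>" "\<theta>' \<in> \<Theta>" for \<theta> \<theta>'
    unfolding prod.case
    by (rule sharp_cost_commute[OF _ _ l_pos c_meas c_sym])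
       (auto intro!: prob_space.prob_space_distr[OF p_prob] G_meas that)
  \<comment> \<open>Openness of \<open>\<Theta> \<times> \<Theta>\<close> turns differentiability
    within the set into full differentiability at the point.\<close>
  moreover have "?F differentiable (at (\<theta>\<^sub>0, \<theta>\<^sub>0))"
    using cost_diff open_Times[OF open_\<Theta> open_\<Theta>] \<theta>\<^sub>0
    by (auto simp: differentiable_on_eq_differentiable_at)
  ultimately have
    "((\<lambda>\<theta>. 2 * ?F (\<theta>, \<theta>\<^sub>0) - ?F (\<theta>, \<theta>)) has_derivative (\<lambda>h. 0)) (at \<theta>\<^sub>0)"
    by (rule has_derivative_symmetric_diagonal[OF open_\<Theta> \<theta>\<^sub>0])
  \<comment> \<open>The last term of the loss, the cost of \<open>q\<close> against itself, is
    constant in \<open>\<theta>\<close>.\<close>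
  then have "((\<lambda>\<theta>. 2 * ?F (\<theta>, \<theta>\<^sub>0) - ?F (\<theta>, \<theta>) - ?F (\<theta>\<^sub>0, \<theta>\<^sub>0)) has_derivative (\<lambda>h. 0 - 0)) (at \<theta>\<^sub>0)"
    by (rule has_derivative_diff) (rule has_derivative_const)
  then show "GDERIV (\<lambda>\<theta>. sinkhorn_loss c R l (?P \<theta>) q) \<theta>\<^sub>0 :> 0"
    by (simp add: gderiv_def sinkhorn_loss_def q)
  \<comment> \<open>With both arguments equal, the three sharp costs coincide and their coefficients
    2, -1, -1 sum to 0.\<close>
  show "sinkhorn_loss c R l (?P \<theta>\<^sub>0) q = 0"
    by (simp add: sinkhorn_loss_def q)
qed

end
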